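(* Let $\mathcal{V}_1,\mathcal{V}_2$ be vector spaces and $T_1:\mathcal{V}_1\to\mathcal{V}_1$, $T_2:\mathcal{V}_2\to\mathcal{V}_2$ linear maps. Let $(\mathcal{W}_1,I_1,U_1,P_1)$ and $(\mathcal{W}_2,I_2,U_2,P_2)$ be the standard dilations of $T_1$ and $T_2$, respectively. If $S:\mathcal{V}_2\to\mathcal{V}_1$ is a linear map such that $T_1S=ST_2$, then there exists a linear map $R:\mathcal{W}_2\to\mathcal{W}_1$ such that $$U_1R=RU_2,\qquad RP_2=P_1R,\qquad RI_2=I_1S.$$ Conversely, if $R:\mathcal{W}_2\to\mathcal{W}_1$ is a linear map such that $U_1R=RU_2$ and $RP_2=P_1R$, then there exists a linear map $S:\mathcal{V}_2\to\mathcal{V}_1$ such that $$RI_2=I_1S,\qquad T_1S=ST_2.$$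
   Context: Vector spaces are over a fixed arbitrary field. The standard dilation of a linear map $T:\mathcal{V}\to\mathcal{V}$ is the quadruple $(\mathcal{W},I,U,P)$ defined as follows: $\mathcal{W}$ is the vector space of all sequences $(x_n)_{n=0}^\infty$ with $x_n\in\mathcal{V}$ for all $n\in\mathbb{Z}_+=\{0,1,2,\dots\}$ and $x_n\neq 0$ for only finitely many $n$, with entrywise operations; $I:\mathcal{V}\to\mathcal{W}$ is $Ix=(x,0,0,\dots)$; $U:\mathcal{W}\to\mathcal{W}$ is $U(x_0,x_1,\dots)=(0,x_0,x_1,\dots)$; and $P:\mathcal{W}\to\mathcal{W}$ is $P(x_n)_{n=0}^\infty=\sum_{n=0}^\infty IT^nx_n$. *)

theory Defs
  imports Complex_Main "HOL-Library.Poly_Mapping"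
begin

text \<open>
  A vector space over a field is a type \<open>'v :: ab_group_add\<close> with a scalar multiplication
  satisfying the locale \<open>vector_space\<close>. The finitely supported sequences in \<open>'v\<close> form
  the type \<open>nat \<Rightarrow>\<^sub>0 'v\<close>, whose group structure is entrywise.
\<close>

definition dil_scale :: "('k :: field \<Rightarrow> 'v \<Rightarrow> 'v :: ab_group_add) \<Rightarrow> 'k \<Rightarrow> (nat \<Rightarrow>\<^sub>0 'v) \<Rightarrow> (nat \<Rightarrow>\<^sub>0 'v)"
  where "dil_scale scale c x = Poly_Mapping.map (scale c) x"

definition dil_I :: "'v :: ab_group_add \<Rightarrow> (nat \<Rightarrow>\<^sub>0 'v)"
  where "dil_I x = Poly_Mapping.single 0 x"

lift_definition dil_U :: "(nat \<Rightarrow>\<^sub>0 'v :: ab_group_add) \<Rightarrow> (nat \<Rightarrow>\<^sub>0 'v)"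
  is "\<lambda>x n. case n of 0 \<Rightarrow> 0 | Suc m \<Rightarrow> x m"
proof -
  fix x :: "nat \<Rightarrow> 'v"
  assume "finite {n. x n \<noteq> 0}"
  moreover have "{n. (case n of 0 \<Rightarrow> 0 | Suc m \<Rightarrow> x m) \<noteq> 0} \<subseteq> Suc ` {n. x n \<noteq> 0}"
    by (auto simp: image_iff gr0_conv_Suc split: nat.splits)
  ultimately show "finite {n. (case n of 0 \<Rightarrow> 0 | Suc m \<Rightarrow> x m) \<noteq> 0}"
    using finite_surj by blast
qed

text \<open>
  The sum over all \<open>n\<close> is restricted to the finite support of \<open>x\<close>; for linear \<open>T\<close>
  the remaining terms vanish.
\<close>

definition dil_P :: "('v \<Rightarrow> 'v) \<Rightarrow> (nat \<Rightarrow>\<^sub>0 'v :: ab_group_add) \<Rightarrow> (nat \<Rightarrow>\<^sub>0 'v)"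
  where "dil_P T x = (\<Sum>n\<in>Poly_Mapping.keys x. dil_I ((T ^^ n) (Poly_Mapping.lookup x n)))"

text \<open>
  The underlying set of the first component is the whole type \<open>nat \<Rightarrow>\<^sub>0 'v\<close>, so that
  component is given by its scalar multiplication.
\<close>

definition standard_dilation ::
  "('k :: field \<Rightarrow> 'v \<Rightarrow> 'v :: ab_group_add) \<Rightarrow> ('v \<Rightarrow> 'v) \<Rightarrow>
    ('k \<Rightarrow> (nat \<Rightarrow>\<^sub>0 'v) \<Rightarrow> (nat \<Rightarrow>\<^sub>0 'v)) \<times> ('v \<Rightarrow> (nat \<Rightarrow>\<^sub>0 'v)) \<times>
    ((nat \<Rightarrow>\<^sub>0 'v) \<Rightarrow> (nat \<Rightarrow>\<^sub>0 'v)) \<times> ((nat \<Rightarrow>\<^sub>0 'v) \<Rightarrow> (nat \<Rightarrow>\<^sub>0 'v))"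
  where "standard_dilation scale T = (dil_scale scale, dil_I, dil_U, dil_P T)"

lemma lookup_dil_scale:
  assumes "vector_space scale"
  shows "Poly_Mapping.lookup (dil_scale scale c x) n = scale c (Poly_Mapping.lookup x n)"
proof -
  interpret vector_space scale by fact
  show ?thesis
    by (simp add: dil_scale_def Poly_Mapping.map.rep_eq when_def)
qed

lemma vector_space_dil_scale:
  assumes "vector_space scale"
  shows "vector_space (dil_scale scale)"
proof -
  interpret vector_space scale by fact
  show ?thesis
    by unfold_locales
      (auto intro!: poly_mapping_eqI
        simp: lookup_dil_scale[OF assms] lookup_add scale_right_distrib scale_left_distrib)
qed

lemma lookup_dil_U:
  "Poly_Mapping.lookup (dil_U x) n = (case n of 0 \<Rightarrow> 0 | Suc m \<Rightarrow> Poly_Mapping.lookup x m)"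
  by (simp add: dil_U.rep_eq)

end

theory Submission
  imports Defs
begin

text \<open>
  An intertwiner \<open>S\<close> is extended by applying it entrywise. Conversely, \<open>R\<close> maps the range of
  \<open>I\<^sub>2\<close> into the range of \<open>I\<^sub>1\<close> because \<open>R I\<^sub>2 = R P\<^sub>2 I\<^sub>2 = P\<^sub>1 R I\<^sub>2\<close>, so it restricts to a map \<open>S\<close>;
  then \<open>P U I = I T\<close> gives
  \<open>I\<^sub>1 S T\<^sub>2 = R P\<^sub>2 U\<^sub>2 I\<^sub>2 = P\<^sub>1 U\<^sub>1 R I\<^sub>2 = I\<^sub>1 T\<^sub>1 S\<close>, and \<open>I\<^sub>1\<close> is injective.
\<close>

lemma lookup_dil_I: "Poly_Mapping.lookup (dil_I x) n = (if n = 0 then x else 0)"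
  by (simp add: dil_I_def lookup_single when_def)

lemma dil_I_eq_iff [simp]: "dil_I x = dil_I y \<longleftrightarrow> x = y"
  by (metis lookup_dil_I)

lemma dil_I_zero [simp]: "dil_I 0 = 0"
  by (simp add: dil_I_def)

lemma dil_I_add: "dil_I (x + y) = dil_I x + dil_I y"
  by (simp add: dil_I_def single_add)

lemma dil_I_sum: "dil_I (sum f A) = (\<Sum>a\<in>A. dil_I (f a))"
  by (induction A rule: infinite_finite_induct) (simp_all add: dil_I_add)

lemma dil_I_scale:
  assumes "vector_space scale"
  shows "dil_I (scale c x) = dil_scale scale c (dil_I x)"
proof -
  interpret vector_space scale by fact
  show ?thesis
    by (intro poly_mapping_eqI) (simp add: lookup_dil_scale[OF assms] lookup_dil_I)
qed

lemma dil_U_dil_I: "dil_U (dil_I x) = Poly_Mapping.single 1 x"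
  by (intro poly_mapping_eqI)
    (auto simp: lookup_dil_U lookup_dil_I lookup_single when_def split: nat.splits)

text \<open>Each power of \<open>T\<close> fixes 0, so enlarging the index set beyond the support
  adds only zero terms. The free choice of \<open>A\<close> lets two values of \<open>dil_P\<close>
  be compared over one index set. The form of the right-hand side also puts the range of
  \<open>dil_P\<close> inside that of \<open>dil_I\<close>.\<close>

lemma dil_P_eq_dil_I:
  assumes "T 0 = 0" and "finite A" and "Poly_Mapping.keys x \<subseteq> A"
  shows "dil_P T x = dil_I (\<Sum>n\<in>A. (T ^^ n) (Poly_Mapping.lookup x n))"
proof -
  have "(T ^^ n) 0 = 0" for n
    by (induction n) (simp_all add: assms(1))
  then show ?thesis
    unfolding dil_P_def dil_I_sum using assms(2,3)
    by (intro sum.mono_neutral_left) (auto simp: in_keys_iff)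
qed

lemma dil_P_single:
  assumes "T 0 = 0"
  shows "dil_P T (Poly_Mapping.single n x) = dil_I ((T ^^ n) x)"
  using dil_P_eq_dil_I[of T "{n}" "Poly_Mapping.single n x"] assms by simp

text \<open>\<open>Poly_Mapping.map\<close> leaves entries outside the support at 0 whatever
  \<open>f\<close> does there, so it is truly entrywise once \<open>f\<close> fixes 0.\<close>

lemma lookup_map_of_zero:
  assumes "f 0 = 0"
  shows "Poly_Mapping.lookup (Poly_Mapping.map f x) n = f (Poly_Mapping.lookup x n)"
  using assms by (simp add: Poly_Mapping.map.rep_eq when_def)

lemma linear_map_dil_scale:
  assumes "Vector_Spaces.linear scale2 scale1 S"
  shows "Vector_Spaces.linear (dil_scale scale2) (dil_scale scale1) (Poly_Mapping.map S)"
proof -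
  interpret S: Vector_Spaces.linear scale2 scale1 S by fact
  have vs: "vector_space scale2" "vector_space scale1"
    by unfold_locales
  show ?thesis
    by (intro Vector_Spaces.linear_iff[THEN iffD2] conjI allI vector_space_dil_scale vs poly_mapping_eqI)
      (simp_all add: lookup_map_of_zero lookup_add S.add S.scale lookup_dil_scale vs)
qed

lemma dil_U_map:
  assumes "S 0 = 0"
  shows "dil_U (Poly_Mapping.map S x) = Poly_Mapping.map S (dil_U x)"
  by (intro poly_mapping_eqI)
    (simp add: lookup_dil_U lookup_map_of_zero assms split: nat.split)

lemma map_dil_I:
  assumes "S 0 = 0"
  shows "Poly_Mapping.map S (dil_I x) = dil_I (S x)"
  by (intro poly_mapping_eqI) (simp add: lookup_dil_I lookup_map_of_zero assms)

lemma funpow_intertwine: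
  assumes "T1 \<circ> S = S \<circ> T2"
  shows "(T1 ^^ n) (S x) = S ((T2 ^^ n) x)"
  using assms by (induction n) (simp_all add: fun_eq_iff)

text \<open>Both sides reduce to \<open>dil_I\<close> of the sum of the
  \<open>S ((T2 ^^ n) x_n)\<close>: on the left each power of \<open>T1\<close> is moved through
  \<open>S\<close>, on the right \<open>S\<close> is moved through the sum.\<close>

lemma dil_P_map:
  assumes "Vector_Spaces.linear scale2 scale1 S" and "T1 0 = 0" and "T2 0 = 0"
    and "T1 \<circ> S = S \<circ> T2"
  shows "dil_P T1 (Poly_Mapping.map S x) = Poly_Mapping.map S (dil_P T2 x)"
proof -
  interpret S: Vector_Spaces.linear scale2 scale1 S by fact
  \<comment> \<open>The inclusion may be strict, since \<open>S\<close> can kill nonzero entries;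
    the support of \<open>x\<close> serves as common index set.\<close>
  have "Poly_Mapping.keys (Poly_Mapping.map S x) \<subseteq> Poly_Mapping.keys x"
    by (auto simp: in_keys_iff lookup_map_of_zero)
  then show ?thesis
    by (simp add: dil_P_eq_dil_I[where A = "Poly_Mapping.keys x"] assms map_dil_I
        lookup_map_of_zero S.sum funpow_intertwine[OF assms(4)])
qed

lemma dilation_intertwiner_restricts:
  assumes R: "Vector_Spaces.linear (dil_scale scale2) (dil_scale scale1) R"
    and vs: "vector_space scale1" "vector_space scale2"
    and T0: "T1 0 = 0" "T2 0 = 0"
    and RU: "\<And>x. dil_U (R x) = R (dil_U x)"
    and RP: "\<And>x. R (dil_P T2 x) = dil_P T1 (R x)"
  shows "\<exists>S. Vector_Spaces.linear scale2 scale1 S \<and> R \<circ> dil_I = dil_I \<circ> S \<and> T1 \<circ> S = S \<circ> T2"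
proof -
  interpret R: Vector_Spaces.linear "dil_scale scale2" "dil_scale scale1" R by fact
  have PI: "dil_P T2 (dil_I x) = dil_I x" for x
    using dil_P_single[of T2 0 x] T0(2) by (simp add: dil_I_def)
  \<comment> \<open>One shift moves the entry to index 1, where \<open>dil_P\<close> applies the map
    exactly once; this recovers the map from its dilation.\<close>
  have PUI1: "dil_P T1 (dil_U (dil_I x)) = dil_I (T1 x)" for x
    by (simp add: dil_U_dil_I dil_P_single T0)
  have PUI2: "dil_P T2 (dil_U (dil_I x)) = dil_I (T2 x)" for x
    by (simp add: dil_U_dil_I dil_P_single T0)
  have "\<exists>y. R (dil_I x) = dil_I y" for x
    using RP[of "dil_I x"] dil_P_eq_dil_I[of T1 "Poly_Mapping.keys (R (dil_I x))" "R (dil_I x)"] T0(1)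
    by (auto simp: PI)
  then obtain S where S: "R (dil_I x) = dil_I (S x)" for x
    by metis
  \<comment> \<open>\<open>S\<close> inherits linearity from \<open>R\<close>, because
    \<open>dil_I\<close> is linear and injective.\<close>
  have "S (x + y) = S x + S y" for x y
    using R.add[of "dil_I x" "dil_I y"] by (simp add: S flip: dil_I_add)
  moreover have "S (scale2 c x) = scale1 c (S x)" for c x
    using R.scale[of c "dil_I x"] by (simp add: S vs flip: dil_I_scale)
  ultimately have "Vector_Spaces.linear scale2 scale1 S"
    by (simp add: Vector_Spaces.linear_iff vs)
  moreover have "T1 (S x) = S (T2 x)" for x
  proof -
    have "dil_I (S (T2 x)) = R (dil_P T2 (dil_U (dil_I x)))"
      by (simp add: PUI2 S)
    \<comment> \<open>\<open>R\<close> is carried inward past \<open>dil_P\<close> and then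
      \<open>dil_U\<close> until it meets \<open>dil_I x\<close> and turns into
      \<open>S\<close>.\<close>
    also have "\<dots> = dil_I (T1 (S x))"
      by (simp add: RP PUI1 S flip: RU)
    finally show ?thesis
      by simp
  qed
  ultimately show ?thesis
    using S by (auto simp: fun_eq_iff)
qed

theorem theorem2p13:
  fixes scale1 :: "'k :: field \<Rightarrow> 'v1 \<Rightarrow> 'v1 :: ab_group_add"
    and scale2 :: "'k \<Rightarrow> 'v2 \<Rightarrow> 'v2 :: ab_group_add"
    and T1 :: "'v1 \<Rightarrow> 'v1" and T2 :: "'v2 \<Rightarrow> 'v2"
  assumes "vector_space scale1" and "vector_space scale2"
    and "Vector_Spaces.linear scale1 scale1 T1"
    and "Vector_Spaces.linear scale2 scale2 T2"
    and "(W1, I1, U1, P1) = standard_dilation scale1 T1"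
    and "(W2, I2, U2, P2) = standard_dilation scale2 T2"
  shows "(\<forall>S. Vector_Spaces.linear scale2 scale1 S \<and> T1 \<circ> S = S \<circ> T2 \<longrightarrow>
           (\<exists>R. Vector_Spaces.linear W2 W1 R \<and>
                U1 \<circ> R = R \<circ> U2 \<and> R \<circ> P2 = P1 \<circ> R \<and> R \<circ> I2 = I1 \<circ> S)) \<and>
         (\<forall>R. Vector_Spaces.linear W2 W1 R \<and> U1 \<circ> R = R \<circ> U2 \<and> R \<circ> P2 = P1 \<circ> R \<longrightarrow>
           (\<exists>S. Vector_Spaces.linear scale2 scale1 S \<and>
                R \<circ> I2 = I1 \<circ> S \<and> T1 \<circ> S = S \<circ> T2))"
proof -
  have [simp]: "W1 = dil_scale scale1" "I1 = dil_I" "U1 = dil_U" "P1 = dil_P T1"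
    "W2 = dil_scale scale2" "I2 = dil_I" "U2 = dil_U" "P2 = dil_P T2"
    using assms(5,6) by (simp_all add: standard_dilation_def)
  interpret T1: Vector_Spaces.linear scale1 scale1 T1 by fact
  interpret T2: Vector_Spaces.linear scale2 scale2 T2 by fact
  show ?thesis
  proof (intro conjI allI impI)
    fix S
    assume S: "Vector_Spaces.linear scale2 scale1 S \<and> T1 \<circ> S = S \<circ> T2"
    \<comment> \<open>This supplies \<open>S 0 = 0\<close>, on which the rules for entrywise
      application rest.\<close>
    then interpret S: Vector_Spaces.linear scale2 scale1 S by blast
    show "\<exists>R. Vector_Spaces.linear W2 W1 R \<and>
      U1 \<circ> R = R \<circ> U2 \<and> R \<circ> P2 = P1 \<circ> R \<and> R \<circ> I2 = I1 \<circ> S"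
      using S dil_P_map[of scale2 scale1 S T1 T2]
      by (intro exI[of _ "Poly_Mapping.map S"])
        (simp add: linear_map_dil_scale dil_U_map map_dil_I fun_eq_iff)
  next
    fix R
    assume "Vector_Spaces.linear W2 W1 R \<and> U1 \<circ> R = R \<circ> U2 \<and> R \<circ> P2 = P1 \<circ> R"
    then show "\<exists>S. Vector_Spaces.linear scale2 scale1 S \<and> R \<circ> I2 = I1 \<circ> S \<and> T1 \<circ> S = S \<circ> T2"
      using dilation_intertwiner_restricts[of scale2 scale1 R T1 T2] assms(1,2)
      by (simp add: fun_eq_iff)
  qed
qed

end
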